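(* Let $W=(W_t)_{t\ge0}$ be a standard Brownian motion and let $f:\mathbb{R}\to\mathbb{R}$ be a measurable function such that $f(W_t)$ is integrable for every $t\ge0$. Then: (a) the process $M_t=f(W_t)-E f(W_t)$, $t\ge0$, is a right-continuous ($P$-a.s.) martingale if and only if $f(x)=ax^2+bx+c$ for all $x\in\mathbb{R}$, for some constants $a,b,c\in\mathbb{R}$; (b) the process $M_t$ is a martingale if and only if $f$ coincides almost everywhere with respect to Lebesgue measure with the function $x\mapsto ax^2+bx+c$ for some constants $a,b,c\in\mathbb{R}$.
   Context: $W$ is a standard Brownian motion on a complete probability space $(\Omega,\mathcal{F},P)$, and $(\mathcal{F}_t)_{t\ge0}$ is the filtration generated by $W$; "martingale" means martingale with respect to this filtration. *)

theory Defs
  imports "HOL-Probability.Probability"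
begin

definition std_brownian_motion :: "'a measure \<Rightarrow> (real \<Rightarrow> 'a \<Rightarrow> real) \<Rightarrow> bool" where
  "std_brownian_motion P W \<longleftrightarrow>
     prob_space P \<and>
     (\<forall>t\<ge>0. W t \<in> borel_measurable P) \<and>
     (AE \<omega> in P. W 0 \<omega> = 0) \<and>
     (AE \<omega> in P. continuous_on {0..} (\<lambda>t. W t \<omega>)) \<and>
     (\<forall>s t. 0 \<le> s \<and> s < t \<longrightarrow>
        distributed P lborel (\<lambda>\<omega>. W t \<omega> - W s \<omega>)
          (\<lambda>x. ennreal (normal_density 0 (sqrt (t - s)) x))) \<and>
     (\<forall>(n::nat) (ts::nat \<Rightarrow> real). 0 \<le> ts 0 \<and> strict_mono ts \<longrightarrow>
        prob_space.indep_vars P (\<lambda>_. borel)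
          (\<lambda>i \<omega>. W (ts (Suc i)) \<omega> - W (ts i) \<omega>) {..<n})"

definition nat_filtration :: "'a measure \<Rightarrow> (real \<Rightarrow> 'a \<Rightarrow> real) \<Rightarrow> real \<Rightarrow> 'a measure" where
  "nat_filtration P W t = sigma (space P)
     {W s -` A \<inter> space P | s A. 0 \<le> s \<and> s \<le> t \<and> A \<in> sets borel}"

definition martingale_wrt :: "'a measure \<Rightarrow> (real \<Rightarrow> 'a measure) \<Rightarrow> (real \<Rightarrow> 'a \<Rightarrow> real) \<Rightarrow> bool" where
  "martingale_wrt P F X \<longleftrightarrow>
     (\<forall>t\<ge>0. X t \<in> borel_measurable (F t) \<and> integrable P (X t)) \<and>
     (\<forall>s t. 0 \<le> s \<and> s \<le> t \<longrightarrow> (AE \<omega> in P. X s \<omega> = real_cond_exp P (F s) (X t) \<omega>))"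

end

theory Submission
  imports Defs "HOL-Real_Asymp.Real_Asymp"
begin

text \<open>
  By the Markov property, \<open>E[f(W\<^sub>t) | F\<^sub>s] = H\<^sub>t\<^sub>-\<^sub>s f (W\<^sub>s)\<close>, where \<open>H\<^sub>u\<close> is the heat semigroup.
  So \<open>M\<close> is a martingale iff \<open>H\<^sub>u f = f + h(u)\<close> almost everywhere, where
  \<open>h(u) = E f(W\<^sub>s\<^sub>+\<^sub>u) - E f(W\<^sub>s)\<close> does not depend on \<open>s\<close> and is therefore additive. Since \<open>H\<^sub>1 f\<close> is
  continuous, \<open>f\<close> has a continuous version, for which the identity holds everywhere. Subtracting
  \<open>h(1) x\<^sup>2\<close> leaves a continuous function that is invariant under \<open>H\<^sub>1\<^sub>/\<^sub>n\<close> for all \<open>n\<close>, and such a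
  function is affine by a maximum principle. If \<open>M\<close> is in addition right-continuous, then each \<open>x\<close>
  is hit by \<open>W\<close> at a positive time with positive probability, which makes \<open>f\<close> agree with the
  quadratic at \<open>x\<close>.
\<close>

subsection \<open>The heat semigroup\<close>

text \<open>The parameter \<open>u\<close> is the variance, hence the standard deviation
  \<open>sqrt u\<close>. At \<open>u = 0\<close> the kernel is 0 by division by zero rather than a
  point mass, so equal times are treated separately.\<close>

definition heat :: "real \<Rightarrow> (real \<Rightarrow> real) \<Rightarrow> real \<Rightarrow> real" where
  "heat u f x = (\<integral>y. normal_density x (sqrt u) y * f y \<partial>lborel)"

text \<open>The class of functions on which the semigroup is given by genuine integrals at every
  point and every positive time.\<close>

definition gauss_integrable :: "(real \<Rightarrow> real) \<Rightarrow> bool" where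
  "gauss_integrable f \<longleftrightarrow> f \<in> borel_measurable borel \<and>
     (\<forall>u>0. \<forall>x. integrable lborel (\<lambda>y. normal_density x (sqrt u) y * f y))"

text \<open>Since y^2 \<le> 2 (y - x)^2 + 2 x^2, doubling the variance absorbs any shift of the
  centre within [-R, R]. This is a majorant uniform in the centre.\<close>

lemma normal_density_shift_le:
  assumes "u > 0" "\<bar>x\<bar> \<le> R"
  shows "normal_density x (sqrt u) y
    \<le> sqrt 2 * exp (R\<^sup>2 / (2 * u)) * normal_density 0 (sqrt (2 * u)) y"
proof -
  have "2 * (y - x)\<^sup>2 + 2 * x\<^sup>2 - y\<^sup>2 = (y - 2 * x)\<^sup>2"
    by (simp add: power2_eq_square algebra_simps)
  then have "y\<^sup>2 \<le> 2 * (y - x)\<^sup>2 + 2 * x\<^sup>2"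
    by (smt (verit) zero_le_power2)
  moreover have "x\<^sup>2 \<le> R\<^sup>2"
    using assms(2) by (metis abs_ge_zero power_mono power2_abs)
  ultimately have "- (y - x)\<^sup>2 / (2 * u) \<le> R\<^sup>2 / (2 * u) + - y\<^sup>2 / (4 * u)"
    using assms(1) by (simp add: field_simps)
  then have "exp (- (y - x)\<^sup>2 / (2 * u)) \<le> exp (R\<^sup>2 / (2 * u)) * exp (- y\<^sup>2 / (4 * u))"
    by (metis exp_add exp_le_cancel_iff)
  then have "exp (- (y - x)\<^sup>2 / (2 * u)) / sqrt (2 * pi * u)
      \<le> exp (R\<^sup>2 / (2 * u)) * exp (- y\<^sup>2 / (4 * u)) / sqrt (2 * pi * u)"
    using assms(1) by (intro divide_right_mono) auto
  also have "1 / sqrt (2 * pi * u) = sqrt 2 / sqrt (2 * pi * (2 * u))"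
    using assms(1) real_sqrt_mult[of 2 "2 * pi * u"] by (simp add: mult.left_commute)
  then have "c / sqrt (2 * pi * u) = sqrt 2 * c / sqrt (2 * pi * (2 * u))" for c
    by (metis mult.commute mult.right_neutral times_divide_eq_left times_divide_eq_right)
  then have "exp (R\<^sup>2 / (2 * u)) * exp (- y\<^sup>2 / (4 * u)) / sqrt (2 * pi * u)
      = sqrt 2 * (exp (R\<^sup>2 / (2 * u)) * exp (- y\<^sup>2 / (4 * u))) / sqrt (2 * pi * (2 * u))" .
  also have "\<dots> = sqrt 2 * exp (R\<^sup>2 / (2 * u)) * normal_density 0 (sqrt (2 * u)) y"
    using assms(1) by (simp add: normal_density_def)
  finally show ?thesis
    using assms(1) by (simp add: normal_density_def)
qed

text \<open>A shifted centre costs only a constant and a doubled variance, so integrability at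
  centre 0 for all variances suffices.\<close>

lemma gauss_integrableI:
  assumes [measurable]: "f \<in> borel_measurable borel"
    and int: "\<And>u. u > 0 \<Longrightarrow> integrable lborel (\<lambda>y. normal_density 0 (sqrt u) y * f y)"
  shows "gauss_integrable f"
  unfolding gauss_integrable_def
proof (intro conjI allI impI)
  fix u x :: real assume u: "u > 0"
  show "integrable lborel (\<lambda>y. normal_density x (sqrt u) y * f y)"
  proof (rule Bochner_Integration.integrable_bound)
    show "integrable lborel (\<lambda>y. sqrt 2 * exp (\<bar>x\<bar>\<^sup>2 / (2 * u)) * (normal_density 0 (sqrt (2 * u)) y * f y))"
      using int[of "2 * u"] u by simp
    show "AE y in lborel. norm (normal_density x (sqrt u) y * f y)
        \<le> norm (sqrt 2 * exp (\<bar>x\<bar>\<^sup>2 / (2 * u)) * (normal_density 0 (sqrt (2 * u)) y * f y))"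
      using mult_right_mono[OF normal_density_shift_le[OF u, of x "\<bar>x\<bar>"], of "\<bar>f y\<bar>" for y]
      by (auto simp: abs_mult mult.assoc)
  qed simp
qed simp

text \<open>Dominated convergence: a convergent sequence of centres is bounded by some
  \<open>R\<close>, and the shift bound then gives a majorant independent of the index.\<close>

lemma continuous_on_heat:
  assumes f: "gauss_integrable f" and u: "u > 0"
  shows "continuous_on UNIV (heat u f)"
proof -
  have [measurable]: "f \<in> borel_measurable borel"
    using f by (simp add: gauss_integrable_def)
  have "isCont (heat u f) x" for x
    unfolding continuous_at_sequentially
  proof (intro allI impI)
    fix z :: "nat \<Rightarrow> real" assume z: "z \<longlonglongrightarrow> x"
    then obtain R where R: "\<And>n. \<bar>z n\<bar> \<le> R"
      by (metis Bseq_def convergentI convergent_imp_Bseq real_norm_def)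
    have "(\<lambda>n. \<integral>y. normal_density (z n) (sqrt u) y * f y \<partial>lborel)
        \<longlonglongrightarrow> (\<integral>y. normal_density x (sqrt u) y * f y \<partial>lborel)"
    proof (rule integral_dominated_convergence)
      show "integrable lborel (\<lambda>y. \<bar>sqrt 2 * exp (R\<^sup>2 / (2 * u)) * (normal_density 0 (sqrt (2 * u)) y * f y)\<bar>)"
        using f u by (simp add: gauss_integrable_def)
      show "AE y in lborel. (\<lambda>n. normal_density (z n) (sqrt u) y * f y)
          \<longlonglongrightarrow> normal_density x (sqrt u) y * f y"
        using u z by (auto simp: normal_density_def intro!: tendsto_intros)
      show "AE y in lborel. norm (normal_density (z n) (sqrt u) y * f y)
          \<le> \<bar>sqrt 2 * exp (R\<^sup>2 / (2 * u)) * (normal_density 0 (sqrt (2 * u)) y * f y)\<bar>" for n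
        using mult_right_mono[OF normal_density_shift_le[OF u R], of "\<bar>f y\<bar>" for y]
        by (auto simp: abs_mult mult.assoc)
    qed auto
    then show "(heat u f \<circ> z) \<longlonglongrightarrow> heat u f x"
      by (simp add: heat_def comp_def)
  qed
  then show ?thesis
    by (simp add: continuous_at_imp_continuous_on)
qed

text \<open>Expanding the quadratic in powers of \<open>y - x\<close> reduces both claims to the
  normal moments of order 2, 1 and 0, which are \<open>u\<close>, 0 and 1.\<close>

lemma
  assumes "u > 0"
  shows integrable_normal_quadratic:
      "integrable lborel (\<lambda>y. normal_density x (sqrt u) y * (a * y\<^sup>2 + b * y + c))" (is ?int)
    and heat_quadratic: "heat u (\<lambda>y. a * y\<^sup>2 + b * y + c) x = a * x\<^sup>2 + b * x + c + a * u" (is ?heat)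
proof -
  have s: "sqrt u > 0" using assms by simp
  have 0: "has_bochner_integral lborel (\<lambda>y. normal_density x (sqrt u) y * (y - x)\<^sup>2) u"
    using normal_moment_even[OF s, of x 1] assms by (simp add: fact_numeral)
  have 1: "has_bochner_integral lborel (\<lambda>y. normal_density x (sqrt u) y * (y - x)) 0"
    using normal_moment_odd[OF s, of x 0] by simp
  have 2: "has_bochner_integral lborel (\<lambda>y. normal_density x (sqrt u) y) 1"
    using normal_moment_even[OF s, of x 0] by simp
  have "has_bochner_integral lborel
     (\<lambda>y. a * (normal_density x (sqrt u) y * (y - x)\<^sup>2)
        + (2 * a * x + b) * (normal_density x (sqrt u) y * (y - x))
        + (a * x\<^sup>2 + b * x + c) * normal_density x (sqrt u) y)
     (a * u + (2 * a * x + b) * 0 + (a * x\<^sup>2 + b * x + c) * 1)"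
    by (intro has_bochner_integral_add has_bochner_integral_mult_right 0 1 2)
  also have "(\<lambda>y. a * (normal_density x (sqrt u) y * (y - x)\<^sup>2)
        + (2 * a * x + b) * (normal_density x (sqrt u) y * (y - x))
        + (a * x\<^sup>2 + b * x + c) * normal_density x (sqrt u) y)
      = (\<lambda>y. normal_density x (sqrt u) y * (a * y\<^sup>2 + b * y + c))"
    by (auto simp: fun_eq_iff power2_eq_square algebra_simps)
  finally show ?int ?heat
    by (auto simp: has_bochner_integral_iff heat_def)
qed

lemma gauss_integrable_quadratic: "gauss_integrable (\<lambda>y. a * y\<^sup>2 + b * y + c)"
  using integrable_normal_quadratic by (simp add: gauss_integrable_def)

text \<open>The one form \<open>k * f y + g y\<close> covers sign changes and, with \<open>g\<close>
  quadratic, all corrections made below. Functions are therefore often written with redundant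
  factors \<open>1\<close> and \<open>0\<close>.\<close>

lemma
  assumes "gauss_integrable f" "gauss_integrable g"
  shows gauss_integrable_lin: "gauss_integrable (\<lambda>y. k * f y + g y)"
    and heat_lin: "u > 0 \<Longrightarrow> heat u (\<lambda>y. k * f y + g y) x = k * heat u f x + heat u g x"
proof -
  have *: "(\<lambda>y. normal_density x (sqrt u) y * (k * f y + g y))
     = (\<lambda>y. k * (normal_density x (sqrt u) y * f y) + normal_density x (sqrt u) y * g y)" for x u
    by (simp add: fun_eq_iff algebra_simps)
  show "gauss_integrable (\<lambda>y. k * f y + g y)"
    using assms unfolding gauss_integrable_def * by auto
  show "heat u (\<lambda>y. k * f y + g y) x = k * heat u f x + heat u g x" if "u > 0"
    using assms that unfolding gauss_integrable_def * heat_def by simp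
qed

section \<open>Maximum principle and rigidity of heat-invariant functions\<close>

text \<open>Within distance \<delta> of \<open>x\<close> the integrand is nonpositive. Farther out
  the kernel of variance 1/n is exponentially small relative to the kernel of variance 1.\<close>

lemma heat_diff_le_at_local_max:
  assumes f: "gauss_integrable f" and \<delta>: "\<delta> > 0"
    and max: "\<And>y. \<bar>y - x\<bar> < \<delta> \<Longrightarrow> f y \<le> f x" and n: "n \<ge> 1"
  shows "heat (1 / real n) f x - f x
    \<le> sqrt n * exp (- (real n - 1) * \<delta>\<^sup>2 / 2) * (\<integral>y. normal_density x 1 y * \<bar>f y - f x\<bar> \<partial>lborel)"
proof -
  have const: "gauss_integrable (\<lambda>y. - f x)"
    using gauss_integrable_quadratic[of 0 0 "- f x"] by simp
  have d: "gauss_integrable (\<lambda>y. f y - f x)"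
    using gauss_integrable_lin[OF f const, of 1] by simp
  have int: "integrable lborel (\<lambda>y. normal_density x (sqrt u) y * (f y - f x))" if "u > 0" for u
    using d that by (simp add: gauss_integrable_def)
  have int1: "integrable lborel (\<lambda>y. normal_density x 1 y * \<bar>f y - f x\<bar>)"
    using integrable_abs[OF int[of 1]] by (simp add: abs_mult)
  have "heat (1 / real n) f x - f x = heat (1 / real n) (\<lambda>y. f y - f x) x"
    using heat_lin[OF f const, of "1 / real n" 1 x] heat_quadratic[of "1 / real n" 0 0 "- f x" x] n by simp
  also have "\<dots> \<le> (\<integral>y. sqrt n * exp (- (real n - 1) * \<delta>\<^sup>2 / 2) * (normal_density x 1 y * \<bar>f y - f x\<bar>) \<partial>lborel)"
    unfolding heat_def
  proof (rule integral_mono)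
    fix y
    show "normal_density x (sqrt (1 / real n)) y * (f y - f x)
      \<le> sqrt n * exp (- (real n - 1) * \<delta>\<^sup>2 / 2) * (normal_density x 1 y * \<bar>f y - f x\<bar>)"
    proof (cases "\<bar>y - x\<bar> < \<delta>")
      case True
      have "normal_density x (sqrt (1 / real n)) y * (f y - f x) \<le> 0"
        using max[OF True] by (simp add: mult_nonneg_nonpos)
      also have "0 \<le> sqrt n * exp (- (real n - 1) * \<delta>\<^sup>2 / 2) * (normal_density x 1 y * \<bar>f y - f x\<bar>)"
        by simp
      finally show ?thesis .
    next
      case False
      then have "\<delta>\<^sup>2 \<le> (y - x)\<^sup>2"
        using \<delta> by (metis abs_le_square_iff abs_of_pos not_less)
      \<comment> \<open>The exponent n is split as (n - 1) + 1: the first part yields the decaying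
        factor, the remaining one keeps a unit-variance kernel for integrability.\<close>
      then have "(real n - 1) * \<delta>\<^sup>2 \<le> (real n - 1) * (y - x)\<^sup>2"
        using n by (intro mult_left_mono) auto
      then have "exp (- real n * (y - x)\<^sup>2 / 2) \<le> exp (- (real n - 1) * \<delta>\<^sup>2 / 2 + - (y - x)\<^sup>2 / 2)"
        by (simp add: algebra_simps)
      then have "sqrt n * exp (- real n * (y - x)\<^sup>2 / 2) / sqrt (2 * pi)
          \<le> sqrt n * (exp (- (real n - 1) * \<delta>\<^sup>2 / 2) * exp (- (y - x)\<^sup>2 / 2)) / sqrt (2 * pi)"
        unfolding exp_add by (intro divide_right_mono mult_left_mono) auto
      moreover have "normal_density x (sqrt (1 / real n)) y
          = sqrt n * exp (- real n * (y - x)\<^sup>2 / 2) / sqrt (2 * pi)"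
        using n by (simp add: normal_density_def real_sqrt_divide real_sqrt_mult power_divide mult.commute)
      ultimately have "normal_density x (sqrt (1 / real n)) y
          \<le> sqrt n * exp (- (real n - 1) * \<delta>\<^sup>2 / 2) * normal_density x 1 y"
        by (simp add: normal_density_def)
      then have "normal_density x (sqrt (1 / real n)) y * (f y - f x)
         \<le> normal_density x (sqrt (1 / real n)) y * \<bar>f y - f x\<bar>"
        "normal_density x (sqrt (1 / real n)) y * \<bar>f y - f x\<bar>
          \<le> sqrt n * exp (- (real n - 1) * \<delta>\<^sup>2 / 2) * normal_density x 1 y * \<bar>f y - f x\<bar>"
        by (auto intro!: mult_left_mono mult_right_mono)
      then show ?thesis by (simp add: mult.assoc)
    qed
  next
    show "integrable lborel (\<lambda>y. normal_density x (sqrt (1 / real n)) y * (f y - f x))"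
      by (rule int) (use n in simp)
    show "integrable lborel (\<lambda>y. sqrt n * exp (- (real n - 1) * \<delta>\<^sup>2 / 2) * (normal_density x 1 y * \<bar>f y - f x\<bar>))"
      by (intro integrable_mult_right int1)
  qed
  also have "\<dots> = sqrt n * exp (- (real n - 1) * \<delta>\<^sup>2 / 2) * (\<integral>y. normal_density x 1 y * \<bar>f y - f x\<bar> \<partial>lborel)"
    by (rule integral_mult_right_zero)
  finally show ?thesis .
qed

text \<open>At an interior maximum the left-hand side of \<open>heat_diff_le_at_local_max\<close> is \<open>\<epsilon> / n\<close> for a perturbation by
  \<open>\<epsilon> (x - p) (x - q)\<close>, whereas the right-hand side decays exponentially.\<close>

lemma heat_invariant_nonpos:
  assumes f: "gauss_integrable f" and cont: "continuous_on UNIV f"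
    and inv: "\<And>n x. n \<ge> 1 \<Longrightarrow> heat (1 / real n) f x = f x"
    and zero: "f p = 0" "f q = 0" and x: "p \<le> x" "x \<le> q"
  shows "f x \<le> 0"
proof (rule ccontr)
  assume "\<not> f x \<le> 0"
  then have fx: "f x > 0" by simp
  then have xx: "p < x" "x < q" using x zero by (auto simp: le_less)
  \<comment> \<open>With this value the perturbation \<epsilon> (y - p) (y - q) equals
    \<open>- f x / 2\<close> at \<open>y = x\<close>, so \<open>g x\<close> stays positive, while it
    vanishes at \<open>p\<close> and \<open>q\<close>.\<close>
  define \<epsilon> where "\<epsilon> = f x / (2 * (x - p) * (q - x))"
  have \<epsilon>: "\<epsilon> > 0" using fx xx by (simp add: \<epsilon>_def)
  define g where "g y = 1 * f y + (\<epsilon> * y\<^sup>2 + - \<epsilon> * (p + q) * y + \<epsilon> * p * q)" for y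
  have g_alt: "g y = f y + \<epsilon> * ((y - p) * (y - q))" for y
    by (simp add: g_def power2_eq_square algebra_simps)
  have "g x > 0"
  proof -
    have "\<epsilon> * ((x - p) * (q - x)) = f x / 2"
      using xx by (simp add: \<epsilon>_def divide_simps)
    moreover have "(x - p) * (x - q) = - ((x - p) * (q - x))" by (simp add: algebra_simps)
    ultimately show ?thesis using fx unfolding g_alt by simp
  qed
  have gi: "gauss_integrable g"
    unfolding g_def by (intro gauss_integrable_lin f gauss_integrable_quadratic)
  have gh: "heat (1 / real n) g z = g z + \<epsilon> / real n" if "n \<ge> 1" for n z
    using that unfolding g_def
    by (subst heat_lin[OF f gauss_integrable_quadratic], simp, subst heat_quadratic)
       (simp_all add: inv)
  have "continuous_on {p..q} g"
    unfolding g_def by (intro continuous_intros continuous_on_subset[OF cont]) auto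
  then obtain m where m: "m \<in> {p..q}" "\<And>y. y \<in> {p..q} \<Longrightarrow> g y \<le> g m"
    using continuous_attains_sup[of "{p..q}" g] xx by auto
  have "g m > 0" using m(2)[of x] \<open>g x > 0\<close> xx by auto
  moreover have "g p = 0" "g q = 0" using zero by (auto simp: g_alt)
  ultimately have mm: "p < m" "m < q" using m(1) by (auto simp: le_less)
  \<comment> \<open>The \<delta>-neighbourhood of \<open>m\<close> lies in [p, q], so the maximum
    over the interval is a local maximum on the line.\<close>
  define \<delta> where "\<delta> = min (m - p) (q - m)"
  have \<delta>: "\<delta> > 0" using mm by (simp add: \<delta>_def)
  have max: "g y \<le> g m" if "\<bar>y - m\<bar> < \<delta>" for y
    by (rule m(2)) (use that in \<open>auto simp: \<delta>_def\<close>)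
  define K where "K = (\<integral>y. normal_density m 1 y * \<bar>g y - g m\<bar> \<partial>lborel)"
  have "\<epsilon> \<le> real n * sqrt n * exp (- (real n - 1) * \<delta>\<^sup>2 / 2) * K" if "n \<ge> 1" for n
    using heat_diff_le_at_local_max[OF gi \<delta> max that] gh[OF that, of m] that
    by (simp add: K_def field_simps)
  then have "\<forall>\<^sub>F n in sequentially. \<epsilon> \<le> real n * sqrt n * exp (- (real n - 1) * \<delta>\<^sup>2 / 2) * K"
    unfolding eventually_sequentially by blast
  moreover have "(\<lambda>n. real n * sqrt n * exp (- (real n - 1) * \<delta>\<^sup>2 / 2)) \<longlonglongrightarrow> 0"
    using \<delta> by real_asymp
  then have "(\<lambda>n. real n * sqrt n * exp (- (real n - 1) * \<delta>\<^sup>2 / 2) * K) \<longlonglongrightarrow> 0 * K"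
    by (intro tendsto_mult tendsto_const)
  ultimately have "\<epsilon> \<le> 0 * K"
    by (intro tendsto_lowerbound[of _ "0 * K" sequentially \<epsilon>]) auto
  then show False using \<epsilon> by simp
qed

text \<open>Subtracting the chord over [-R, R] leaves an invariant function vanishing at both ends.
  Nonpositivity of it and of its negative makes it zero.\<close>

lemma heat_invariant_affine:
  assumes f: "gauss_integrable f" and cont: "continuous_on UNIV f"
    and inv: "\<And>n x. n \<ge> 1 \<Longrightarrow> heat (1 / real n) f x = f x"
  shows "f x = (f 1 - f 0) * x + f 0"
proof -
  \<comment> \<open>\<open>R\<close> is at least 1 so that 0 and 1 lie in the interval and determine
    the chord independently of \<open>R\<close>.\<close>
  define R where "R = max 1 \<bar>x\<bar>"
  define b where "b = (f R - f (- R)) / (2 * R)"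
  define c where "c = (f R + f (- R)) / 2"
  have R: "R > 0" by (simp add: R_def)
  have line: "f y = b * y + c" if y: "- R \<le> y" "y \<le> R" for y
  proof -
    have ends: "f R = b * R + c" "f (- R) = b * - R + c"
      using R by (simp_all add: b_def c_def field_simps)
    have aux: "k * f y + (0 * y\<^sup>2 + - k * b * y + - k * c) \<le> 0" for k
    proof (rule heat_invariant_nonpos[where p = "- R" and q = R and x = y
          and f = "\<lambda>y. k * f y + (0 * y\<^sup>2 + - k * b * y + - k * c)"])
      show "gauss_integrable (\<lambda>y. k * f y + (0 * y\<^sup>2 + - k * b * y + - k * c))"
        by (intro gauss_integrable_lin f gauss_integrable_quadratic)
      show "continuous_on UNIV (\<lambda>y. k * f y + (0 * y\<^sup>2 + - k * b * y + - k * c))"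
        by (intro continuous_intros cont)
      fix n :: nat and z assume n: "n \<ge> 1"
      then show "heat (1 / real n) (\<lambda>y. k * f y + (0 * y\<^sup>2 + - k * b * y + - k * c)) z
          = k * f z + (0 * z\<^sup>2 + - k * b * z + - k * c)"
        by (subst heat_lin[OF f gauss_integrable_quadratic], simp, subst heat_quadratic)
           (simp_all add: inv)
    qed (use ends y in \<open>auto simp: algebra_simps\<close>)
    show ?thesis using aux[of 1] aux[of "- 1"] by simp
  qed
  show ?thesis
    using line[of x] line[of 0] line[of 1] R by (auto simp: R_def)
qed

text \<open>The function a x^2 gains exactly a/n at time 1/n, so subtracting it reduces the claim to
  the invariant case.\<close>

lemma heat_translate_quadratic:
  assumes f: "gauss_integrable f" and cont: "continuous_on UNIV f"
    and h: "\<And>n x. n \<ge> 1 \<Longrightarrow> heat (1 / real n) f x = f x + a / real n"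
  shows "\<exists>b c. \<forall>x. f x = a * x\<^sup>2 + b * x + c"
proof -
  define g where "g y = 1 * f y + (- a * y\<^sup>2 + 0 * y + 0)" for y
  have "g x = (g 1 - g 0) * x + g 0" for x
  proof (rule heat_invariant_affine)
    show "gauss_integrable g"
      unfolding g_def by (intro gauss_integrable_lin f gauss_integrable_quadratic)
    show "continuous_on UNIV g"
      unfolding g_def by (intro continuous_intros cont)
    fix n :: nat and z assume n: "n \<ge> 1"
    then show "heat (1 / real n) g z = g z"
      unfolding g_def
      by (subst heat_lin[OF f gauss_integrable_quadratic], simp, subst heat_quadratic)
         (simp_all add: h)
  qed
  then have "\<forall>x. f x = a * x\<^sup>2 + (g 1 - g 0) * x + g 0"
    by (simp add: g_def algebra_simps)
  then show ?thesis by blast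
qed

section \<open>Measurability, normal laws and Lebesgue null sets\<close>

lemma heat_measurable:
  assumes [measurable]: "f \<in> borel_measurable borel"
  shows "heat u f \<in> borel_measurable borel"
proof -
  have "(\<lambda>x. \<integral>y. normal_density x (sqrt u) y * f y \<partial>lborel) \<in> borel_measurable borel"
    unfolding normal_density_def by measurable
  then show ?thesis by (simp add: heat_def[abs_def])
qed

text \<open>Translation by \<open>x\<close> turns an integral over the law of a Brownian increment
  into the kernel centred at the current position.\<close>

lemma heat_eq_integral_density:
  assumes [measurable]: "f \<in> borel_measurable borel"
  shows "(\<integral>y. f (x + y) \<partial>density lborel (\<lambda>y. ennreal (normal_density 0 (sqrt u) y))) = heat u f x"
proof -
  have "heat u f x = (\<integral>y. normal_density x (sqrt u) (x + y) * f (x + y) \<partial>lborel)"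
    unfolding heat_def by (subst lborel_integral_real_affine[where c = 1 and t = x]) auto
  also have "\<dots> = (\<integral>y. normal_density 0 (sqrt u) y * f (x + y) \<partial>lborel)"
    by (simp add: normal_density_def)
  finally show ?thesis by (simp add: integral_real_density)
qed

text \<open>The normal density is strictly positive, so the normal law and Lebesgue measure have the
  same null sets.\<close>

lemma AE_normal_distributed_iff:
  assumes X: "distributed M lborel X (\<lambda>x. ennreal (normal_density \<mu> \<sigma> x))" and "\<sigma> > 0"
    and Q: "Measurable.pred borel Q"
  shows "(AE \<omega> in M. Q (X \<omega>)) \<longleftrightarrow> (AE x in lborel. Q x)"
proof -
  have "(AE \<omega> in M. Q (X \<omega>)) \<longleftrightarrow> (AE x in distr M lborel X. Q x)"
    using distributed_measurable[OF X] Q by (subst AE_distr_iff) (auto simp: pred_def)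
  also have "\<dots> \<longleftrightarrow> (AE x in lborel. 0 < ennreal (normal_density \<mu> \<sigma> x) \<longrightarrow> Q x)"
    unfolding distributed_distr_eq_density[OF X] by (rule AE_density) simp
  also have "\<dots> \<longleftrightarrow> (AE x in lborel. Q x)"
    using normal_density_pos[OF \<open>\<sigma> > 0\<close>] by simp
  finally show ?thesis .
qed

lemma (in prob_space) prob_normal_interval_pos:
  assumes X: "distributed M lborel X (\<lambda>x. ennreal (normal_density \<mu> \<sigma> x))" and "\<sigma> > 0"
    and B: "open B" "B \<noteq> {}"
  shows "prob (X -` B \<inter> space M) > 0"
proof (rule ccontr)
  have [measurable]: "X \<in> borel_measurable M" using distributed_measurable[OF X] by simp
  have BM: "B \<in> sets borel" using B by simp
  assume "\<not> ?thesis"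
  then have "prob (X -` B \<inter> space M) = 0" by (simp add: zero_less_measure_iff)
  then have "AE \<omega> in M. X \<omega> \<notin> B"
    using BM by (subst AE_iff_measurable[of "X -` B \<inter> space M"])
      (auto simp: emeasure_eq_measure intro: measurable_sets)
  then have "AE x in lborel. x \<notin> B"
    using BM by (subst (asm) AE_normal_distributed_iff[OF X \<open>\<sigma> > 0\<close>]) auto
  \<comment> \<open>The complement of \<open>B\<close> is closed and of full measure, hence the
    whole line.\<close>
  then have "AE x in lebesgue. x \<in> - B"
    by (simp add: AE_completion_iff)
  then have "x \<in> - B" for x
    using B by (intro mem_closed_if_AE_lebesgue) auto
  then show False using B by auto
qed

text \<open>The coincidence set is closed and has full measure.\<close>

lemma AE_lborel_eq_imp_eq:
  fixes f g :: "real \<Rightarrow> real"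
  assumes "continuous_on UNIV f" "continuous_on UNIV g" "AE x in lborel. f x = g x"
  shows "f x = g x"
proof -
  have "AE x in lebesgue. x \<in> {x. f x = g x}"
    using assms(3) by (simp add: AE_completion_iff)
  moreover have "closed {x. f x = g x}"
    using assms by (intro closed_Collect_eq)
  ultimately show ?thesis
    using mem_closed_if_AE_lebesgue by blast
qed

lemma heat_cong_AE:
  assumes "AE x in lborel. f x = g x" "f \<in> borel_measurable borel" "g \<in> borel_measurable borel"
  shows "heat u f x = heat u g x"
  unfolding heat_def by (rule integral_cong_AE) (use assms in auto)

lemma heat_diff_const:
  assumes "gauss_integrable f" "u > 0"
  shows "heat u (\<lambda>y. f y - c) x = heat u f x - c"
  using heat_lin[OF assms(1) gauss_integrable_quadratic[of 0 0 "- c"] assms(2), of 1 x]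
    heat_quadratic[OF assms(2), of 0 0 "- c" x] by simp

subsection \<open>The Markov property\<close>

locale brownian_motion =
  fixes P :: "'a measure" and W :: "real \<Rightarrow> 'a \<Rightarrow> real"
  assumes BM: "std_brownian_motion P W"
begin

sublocale prob_space P
  using BM by (simp add: std_brownian_motion_def)

lemma W_measurable [measurable]: "t \<ge> 0 \<Longrightarrow> W t \<in> borel_measurable P"
  using BM by (simp add: std_brownian_motion_def)

lemma W_0: "AE \<omega> in P. W 0 \<omega> = 0"
  using BM by (simp add: std_brownian_motion_def)

lemma W_continuous: "AE \<omega> in P. continuous_on {0..} (\<lambda>t. W t \<omega>)"
  using BM by (simp add: std_brownian_motion_def)

lemma W_increment_distributed:
  "0 \<le> s \<Longrightarrow> s < t \<Longrightarrow>
    distributed P lborel (\<lambda>\<omega>. W t \<omega> - W s \<omega>) (\<lambda>x. ennreal (normal_density 0 (sqrt (t - s)) x))"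
  using BM by (simp add: std_brownian_motion_def)

lemma W_distributed:
  assumes "0 < t"
  shows "distributed P lborel (W t) (\<lambda>x. ennreal (normal_density 0 (sqrt t) x))"
proof -
  \<comment> \<open>The path starts at 0 only almost surely, so the two variables are compared
    through their laws.\<close>
  have "distr P lborel (\<lambda>\<omega>. W t \<omega> - W 0 \<omega>) = distr P lborel (W t)"
    by (rule distr_cong_AE) (use W_0 assms in auto)
  then show ?thesis
    using W_increment_distributed[of 0 t] assms by (simp add: distributed_def)
qed

lemma increments_indep_vars:
  assumes "0 \<le> ts 0" "strict_mono ts"
  shows "indep_vars (\<lambda>_. borel) (\<lambda>i \<omega>. W (ts (Suc i)) \<omega> - W (ts i) \<omega>) {..<n}"
  using BM assms unfolding std_brownian_motion_def by blast

section \<open>The natural filtration and its independence of later increments\<close>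

lemma subalgebra_nat_filtration: "subalgebra P (nat_filtration P W t)"
  unfolding subalgebra_def nat_filtration_def
  by (auto simp: space_measure_of_conv sets_measure_of_conv intro!: sets.sigma_sets_subset
        measurable_sets[OF W_measurable])

lemma space_nat_filtration: "space (nat_filtration P W t) = space P"
  by (simp add: nat_filtration_def space_measure_of_conv)

lemma W_adapted:
  assumes "0 \<le> s" "s \<le> t"
  shows "W s \<in> borel_measurable (nat_filtration P W t)"
proof (rule measurableI)
  fix A :: "real set" assume A: "A \<in> sets borel"
  have "W s -` A \<inter> space P \<in> sigma_sets (space P) {W s -` A \<inter> space P | s A. 0 \<le> s \<and> s \<le> t \<and> A \<in> sets borel}"
    using A assms by (intro sigma_sets.Basic) blast
  then show "W s -` A \<inter> space (nat_filtration P W t) \<in> sets (nat_filtration P W t)"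
    unfolding space_nat_filtration
    by (auto simp: nat_filtration_def sets_measure_of_conv)
qed simp

lemma sigma_finite_subalgebra_nat_filtration:
  "sigma_finite_subalgebra P (nat_filtration P W t)"
  by (rule finite_measure_subalgebra_is_sigma_finite)
     (simp add: finite_measure_subalgebra_def finite_measure_axioms
        finite_measure_subalgebra_axioms_def subalgebra_nat_filtration)

text \<open>An intersection-stable generator of the filtration. Events constraining a single time
  are in general not closed under intersection.\<close>

definition cylinders :: "real \<Rightarrow> 'a set set" where
  "cylinders s = {{\<omega> \<in> space P. \<forall>r\<in>J. W r \<omega> \<in> A r} | J A.
     finite J \<and> J \<subseteq> {0..s} \<and> (\<forall>r\<in>J. A r \<in> sets borel)}"

lemma Int_stable_cylinders: "Int_stable (cylinders s)"
proof (rule Int_stableI)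
  fix C D assume "C \<in> cylinders s" "D \<in> cylinders s"
  then obtain J A K B
    where C: "C = {\<omega> \<in> space P. \<forall>r\<in>J. W r \<omega> \<in> A r}"
        "finite J" "J \<subseteq> {0..s}" "\<forall>r\<in>J. A r \<in> sets borel"
      and D: "D = {\<omega> \<in> space P. \<forall>r\<in>K. W r \<omega> \<in> B r}"
        "finite K" "K \<subseteq> {0..s}" "\<forall>r\<in>K. B r \<in> sets borel"
    by (auto simp: cylinders_def)
  define E where "E r = (if r \<in> J then A r else UNIV) \<inter> (if r \<in> K then B r else UNIV)" for r
  have "C \<inter> D = {\<omega> \<in> space P. \<forall>r\<in>J \<union> K. W r \<omega> \<in> E r}"
    unfolding C D E_def by auto
  moreover have "\<forall>r\<in>J \<union> K. E r \<in> sets borel"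
    using C D by (auto simp: E_def)
  ultimately show "C \<inter> D \<in> cylinders s"
    unfolding cylinders_def using C D by (intro CollectI exI[of _ "J \<union> K"] exI[of _ E]) auto
qed

lemma cylinders_subset: "cylinders s \<subseteq> sets P"
proof
  fix C assume "C \<in> cylinders s"
  then obtain J A where C: "C = {\<omega> \<in> space P. \<forall>r\<in>J. W r \<omega> \<in> A r}"
        "finite J" "J \<subseteq> {0..s}" "\<forall>r\<in>J. A r \<in> sets borel"
    by (auto simp: cylinders_def)
  have "{\<omega> \<in> space P. W r \<omega> \<in> A r} \<in> sets P" if "r \<in> J" for r
    using measurable_sets[OF W_measurable[of r], of "A r"] that C
    by (auto simp: vimage_def Int_def conj_commute)
  then show "C \<in> sets P"
    unfolding C(1) using C(2) by (intro sets.sets_Collect_finite_All) auto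
qed

lemma sets_nat_filtration_subset:
  "sets (nat_filtration P W s) \<subseteq> sigma_sets (space P) (cylinders s)"
proof -
  have "{W r -` A \<inter> space P | r A. 0 \<le> r \<and> r \<le> s \<and> A \<in> sets borel} \<subseteq> cylinders s"
  proof safe
    fix r and A :: "real set" assume "0 \<le> r" "r \<le> s" "A \<in> sets borel"
    then show "W r -` A \<inter> space P \<in> cylinders s"
      unfolding cylinders_def
      by (intro CollectI exI[of _ "{r}"] exI[of _ "\<lambda>_. A"]) auto
  qed
  then have "sigma_sets (space P) {W r -` A \<inter> space P | r A. 0 \<le> r \<and> r \<le> s \<and> A \<in> sets borel}
      \<subseteq> sigma_sets (space P) (cylinders s)"
    by (rule sigma_sets_mono')
  then show ?thesis
    unfolding nat_filtration_def by (subst sets_measure_of) auto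
qed

text \<open>On a grid containing 0, \<open>s\<close> and \<open>J\<close>, each \<open>W r\<close>
  is almost surely a sum of increments before \<open>s\<close>. The cylinder is thus an event of the
  earlier increments, which are independent of the one from \<open>s\<close> to
  \<open>t\<close>.\<close>

lemma prob_cylinder_increment:
  assumes st: "0 \<le> s" "s < t" and J: "finite J" "J \<subseteq> {0..s}"
    and A: "\<And>r. r \<in> J \<Longrightarrow> A r \<in> sets borel" and B: "B \<in> sets borel"
  shows "prob ({\<omega> \<in> space P. \<forall>r\<in>J. W r \<omega> \<in> A r} \<inter> ((\<lambda>\<omega>. W t \<omega> - W s \<omega>) -` B \<inter> space P))
    = prob {\<omega> \<in> space P. \<forall>r\<in>J. W r \<omega> \<in> A r} * prob ((\<lambda>\<omega>. W t \<omega> - W s \<omega>) -` B \<inter> space P)"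
proof -
  \<comment> \<open>Including 0 lets values be recovered from increments; including \<open>s\<close>
    makes the step from \<open>s\<close> to \<open>t\<close> a single increment.\<close>
  define S where "S = insert 0 (insert s J)"
  define xs where "xs = sorted_list_of_set S"
  define m where "m = length xs - 1"
  have S: "finite S" "S \<subseteq> {0..s}" "0 \<in> S" "s \<in> S"
    using st J by (auto simp: S_def)
  have xs: "set xs = S" "sorted_wrt (<) xs"
    using S by (auto simp: xs_def)
  have len: "length xs = Suc m"
    using xs(1) S(3) by (cases xs) (auto simp: m_def)
  have nth: "xs ! i \<in> {0..s}" if "i \<le> m" for i
    using that len xs(1) S(2) nth_mem[of i xs] by auto
  have mono: "xs ! i < xs ! j" if "i < j" "j \<le> m" for i j
    using sorted_wrt_nth_less[OF xs(2)] that len by simp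
  \<comment> \<open>The definition of Brownian motion asks for an infinite strictly increasing
    sequence, so the grid is continued by t, t + 1, and so on. Index \<open>m\<close> is
    \<open>s\<close> and index \<open>Suc m\<close> is \<open>t\<close>.\<close>
  define ts where "ts i = (if i \<le> m then xs ! i else t + real (i - Suc m))" for i
  have "strict_mono ts"
  proof (rule strict_monoI)
    fix i j :: nat assume "i < j"
    then show "ts i < ts j"
      using mono[of i j] nth[of i] st by (auto simp: ts_def)
  qed
  have index: "\<exists>i\<le>m. r = ts i" if "r \<in> S" for r
    using that xs(1) len by (auto simp: ts_def in_set_conv_nth less_Suc_eq_le)
  have ts0: "ts 0 = 0"
    using index[OF S(3)] nth[of 0] mono[of 0] by (auto simp: ts_def) (metis gr0I less_le_not_le)
  have tsm: "ts m = s"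
    using index[OF S(4)] nth[of m] mono[of _ m] by (auto simp: ts_def) (metis le_less less_le_not_le)
  have tsSuc: "ts (Suc m) = t"
    by (simp add: ts_def)
  obtain k where k: "\<And>r. r \<in> J \<Longrightarrow> k r \<le> m \<and> r = ts (k r)"
    using index by (metis S_def insertCI)
  define X where "X i \<omega> = W (ts (Suc i)) \<omega> - W (ts i) \<omega>" for i \<omega>
  \<comment> \<open>\<open>U\<close> collects the increments up to time \<open>s\<close>, and
    \<open>V\<close> the single increment from \<open>s\<close> to \<open>t\<close>; disjoint blocks
    of independent variables are independent.\<close>
  define U where "U \<omega> = restrict (\<lambda>i. X i \<omega>) {..<m}" for \<omega>
  define V where "V \<omega> = restrict (\<lambda>i. X i \<omega>) {m}" for \<omega>
  define B' where "B' = (\<lambda>x. x m) -` B \<inter> space (Pi\<^sub>M {m} (\<lambda>_. borel :: real measure))"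
  define C where "C = {x \<in> space (Pi\<^sub>M {..<m} (\<lambda>_. borel :: real measure)). \<forall>r\<in>J. (\<Sum>i<k r. x i) \<in> A r}"
  have "indep_vars (\<lambda>_. borel) X {..<Suc m}"
    unfolding X_def by (rule increments_indep_vars) (use ts0 \<open>strict_mono ts\<close> in auto)
  from indep_var_restrict[OF this, of "{..<m}" "{m}"]
  have ind: "indep_var (Pi\<^sub>M {..<m} (\<lambda>_. borel)) U (Pi\<^sub>M {m} (\<lambda>_. borel)) V"
    by (simp add: U_def[abs_def] V_def[abs_def])
  have C: "C \<in> sets (Pi\<^sub>M {..<m} (\<lambda>_. borel))"
    unfolding C_def
  proof (rule sets.sets_Collect_finite_All[OF _ J(1)])
    fix r assume r: "r \<in> J"
    have "(\<lambda>x. \<Sum>i<k r. x i) \<in> borel_measurable (Pi\<^sub>M {..<m} (\<lambda>_. borel :: real measure))"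
      using k[OF r] by (intro borel_measurable_sum measurable_component_singleton) auto
    from measurable_sets[OF this A[OF r]]
    show "{x \<in> space (Pi\<^sub>M {..<m} (\<lambda>_. borel :: real measure)). (\<Sum>i<k r. x i) \<in> A r}
        \<in> sets (Pi\<^sub>M {..<m} (\<lambda>_. borel))"
      by (simp add: vimage_def Int_def conj_commute)
  qed
  have sumU: "W r \<omega> - W 0 \<omega> = (\<Sum>i<k r. U \<omega> i)" if "r \<in> J" for r \<omega>
  proof -
    have "(\<Sum>i<k r. U \<omega> i) = (\<Sum>i<k r. W (ts (Suc i)) \<omega> - W (ts i) \<omega>)"
      using k[OF that] by (intro sum.cong) (auto simp: U_def X_def)
    also have "\<dots> = W (ts (k r)) \<omega> - W (ts 0) \<omega>"
      by (rule sum_lessThan_telescope)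
    finally show ?thesis using k[OF that] ts0 by simp
  qed
  have eq: "AE \<omega> in P. \<omega> \<in> {\<omega> \<in> space P. \<forall>r\<in>J. W r \<omega> \<in> A r} \<longleftrightarrow> \<omega> \<in> U -` C \<inter> space P"
    using W_0
  proof eventually_elim
    case (elim \<omega>)
    then have "W r \<omega> = (\<Sum>i<k r. U \<omega> i)" if "r \<in> J" for r
      using sumU[OF that, of \<omega>] by simp
    moreover have "U \<omega> \<in> space (Pi\<^sub>M {..<m} (\<lambda>_. borel))"
      by (simp add: U_def space_PiM)
    ultimately show ?case by (auto simp: C_def)
  qed
  have E: "{\<omega> \<in> space P. \<forall>r\<in>J. W r \<omega> \<in> A r} \<in> sets P"
  proof -
    have "{\<omega> \<in> space P. \<forall>r\<in>J. W r \<omega> \<in> A r} \<in> cylinders s"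
      unfolding cylinders_def using J A by blast
    then show ?thesis using cylinders_subset by blast
  qed
  have UC: "U -` C \<inter> space P \<in> sets P"
    using indep_var_rv1[OF ind] C by (rule measurable_sets)
  have B': "B' \<in> sets (Pi\<^sub>M {m} (\<lambda>_. borel))"
    unfolding B'_def by (rule measurable_sets[OF _ B]) simp
  have V: "(\<lambda>\<omega>. W t \<omega> - W s \<omega>) -` B \<inter> space P = V -` B' \<inter> space P"
    by (auto simp: V_def B'_def X_def tsm tsSuc space_PiM)
  have VB: "V -` B' \<inter> space P \<in> sets P"
    using indep_var_rv2[OF ind] B' by (rule measurable_sets)
  have "prob ({\<omega> \<in> space P. \<forall>r\<in>J. W r \<omega> \<in> A r} \<inter> (V -` B' \<inter> space P))
      = prob ((U -` C \<inter> space P) \<inter> (V -` B' \<inter> space P))"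
    by (rule finite_measure_eq_AE) (use eq E UC VB in auto)
  also have "\<dots> = prob ((\<lambda>\<omega>. (U \<omega>, V \<omega>)) -` (C \<times> B') \<inter> space P)"
    by (rule arg_cong[where f = prob]) auto
  also have "\<dots> = prob (U -` C \<inter> space P) * prob (V -` B' \<inter> space P)"
    by (rule indep_varD[OF ind C B'])
  also have "prob (U -` C \<inter> space P) = prob {\<omega> \<in> space P. \<forall>r\<in>J. W r \<omega> \<in> A r}"
    by (rule finite_measure_eq_AE) (use eq E UC in auto)
  finally show ?thesis by (simp add: V)
qed

text \<open>Both generating families are intersection-stable, so their independence extends to the
  generated \<sigma>-algebras.\<close>

lemma indep_set_nat_filtration_increment:
  assumes st: "0 \<le> s" "s < t"
  shows "indep_set (sets (nat_filtration P W s))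
    (sigma_sets (space P) {(\<lambda>\<omega>. W t \<omega> - W s \<omega>) -` B \<inter> space P | B. B \<in> sets borel})"
    (is "indep_set _ (sigma_sets _ ?V)")
proof -
  have D: "(\<lambda>\<omega>. W t \<omega> - W s \<omega>) \<in> borel_measurable P"
    using st by simp
  have "indep_set (cylinders s) ?V"
  proof (rule indep_setI)
    show "?V \<subseteq> events" using D by auto
    show "prob (C \<inter> D) = prob C * prob D" if "C \<in> cylinders s" "D \<in> ?V" for C D
      using that prob_cylinder_increment[OF st] by (auto simp: cylinders_def)
  qed (rule cylinders_subset)
  moreover have "Int_stable ?V"
  proof (rule Int_stableI)
    fix C D assume "C \<in> ?V" "D \<in> ?V"
    then obtain B B' where "B \<in> sets borel" "B' \<in> sets borel"
      "C = (\<lambda>\<omega>. W t \<omega> - W s \<omega>) -` B \<inter> space P" "D = (\<lambda>\<omega>. W t \<omega> - W s \<omega>) -` B' \<inter> space P"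
      by auto
    then show "C \<inter> D \<in> ?V" by (intro CollectI exI[of _ "B \<inter> B'"]) auto
  qed
  ultimately have "indep_set (sigma_sets (space P) (cylinders s)) (sigma_sets (space P) ?V)"
    by (intro indep_set_sigma_sets Int_stable_cylinders)
  then show ?thesis
    using sets_nat_filtration_subset[of s] by (auto simp: indep_sets2_eq)
qed

text \<open>The map \<open>g\<close> is needed because \<open>indep_var\<close> forces both variables to have the same type.\<close>

lemma indep_var_nat_filtration_increment:
  assumes st: "0 \<le> s" "s < t" and Y: "Y \<in> measurable (nat_filtration P W s) N"
    and g: "g \<in> measurable borel N'"
  shows "indep_var N Y N' (\<lambda>\<omega>. g (W t \<omega> - W s \<omega>))"
  unfolding indep_var_eq
proof (intro conjI)
  show "random_variable N Y"
    using measurable_from_subalg[OF subalgebra_nat_filtration Y] .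
  have "(\<lambda>\<omega>. W t \<omega> - W s \<omega>) \<in> borel_measurable P"
    using st by simp
  then show "random_variable N' (\<lambda>\<omega>. g (W t \<omega> - W s \<omega>))"
    by (rule measurable_compose[OF _ g])
  have "{Y -` A \<inter> space P |A. A \<in> sets N} \<subseteq> sets (nat_filtration P W s)"
    using measurable_sets[OF Y] by (auto simp: space_nat_filtration)
  then have "sigma_sets (space P) {Y -` A \<inter> space P |A. A \<in> sets N} \<subseteq> sets (nat_filtration P W s)"
    using sets.sigma_sets_subset[of _ "nat_filtration P W s"] by (simp add: space_nat_filtration)
  moreover have "{(\<lambda>\<omega>. g (W t \<omega> - W s \<omega>)) -` A \<inter> space P |A. A \<in> sets N'}
      \<subseteq> {(\<lambda>\<omega>. W t \<omega> - W s \<omega>) -` B \<inter> space P |B. B \<in> sets borel}"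
  proof safe
    fix A assume "A \<in> sets N'"
    then have "g -` A \<in> sets borel" using measurable_sets[OF g] by simp
    then show "\<exists>B. (\<lambda>\<omega>. g (W t \<omega> - W s \<omega>)) -` A \<inter> space P
        = (\<lambda>\<omega>. W t \<omega> - W s \<omega>) -` B \<inter> space P \<and> B \<in> sets borel"
      by (intro exI[of _ "g -` A"]) auto
  qed
  then have "sigma_sets (space P) {(\<lambda>\<omega>. g (W t \<omega> - W s \<omega>)) -` A \<inter> space P |A. A \<in> sets N'}
      \<subseteq> sigma_sets (space P) {(\<lambda>\<omega>. W t \<omega> - W s \<omega>) -` B \<inter> space P |B. B \<in> sets borel}"
    by (rule sigma_sets_mono')
  ultimately show "indep_set (sigma_sets (space P) {Y -` A \<inter> space P |A. A \<in> sets N})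
     (sigma_sets (space P) {(\<lambda>\<omega>. g (W t \<omega> - W s \<omega>)) -` A \<inter> space P |A. A \<in> sets N'})"
    using indep_set_nat_filtration_increment[OF st] unfolding indep_sets2_eq by blast
qed

text \<open>For \<open>A\<close> in the past, the pair of its indicator and \<open>W s\<close> is
  independent of the increment. The joint law is a product, and Fubini integrates out the increment
  first, producing the heat semigroup.\<close>

lemma cond_exp_W:
  assumes st: "0 \<le> s" "s < t" and [measurable]: "f \<in> borel_measurable borel"
    and int: "integrable P (\<lambda>\<omega>. f (W t \<omega>))"
  shows "AE \<omega> in P. real_cond_exp P (nat_filtration P W s) (\<lambda>\<omega>. f (W t \<omega>)) \<omega>
    = heat (t - s) f (W s \<omega>)"
proof -
  let ?F = "nat_filtration P W s"
  interpret F: sigma_finite_subalgebra P ?F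
    by (rule sigma_finite_subalgebra_nat_filtration)
  note heat_measurable[measurable]
  have W_F [measurable]: "W s \<in> borel_measurable ?F" using W_adapted st by simp
  have [measurable]: "W s \<in> borel_measurable P" "W t \<in> borel_measurable P" using st by auto
  have main: "integrable P (\<lambda>\<omega>. indicator A \<omega> * heat (t - s) f (W s \<omega>)) \<and>
      (\<integral>\<omega>. indicator A \<omega> * f (W t \<omega>) \<partial>P) = (\<integral>\<omega>. indicator A \<omega> * heat (t - s) f (W s \<omega>) \<partial>P)"
    if A: "A \<in> sets ?F" for A
  proof -
    \<comment> \<open>Indicator and position form one variable, because independence from the
      increment must hold for them jointly.\<close>
    define Y where "Y \<omega> = (indicator A \<omega> :: real, W s \<omega>)" for \<omega>
    define D where "D \<omega> = W t \<omega> - W s \<omega>" for \<omega>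
    define L where "L = distr P (borel \<Otimes>\<^sub>M borel) Y"
    define N where "N = distr P (borel \<Otimes>\<^sub>M borel) (\<lambda>\<omega>. (0 :: real, D \<omega>))"
    have AP [measurable]: "A \<in> sets P" using A subalgebra_nat_filtration by (auto simp: subalgebra_def)
    have "Y \<in> measurable ?F (borel \<Otimes>\<^sub>M borel)"
      unfolding Y_def using A by measurable
    from indep_var_nat_filtration_increment[OF st this, of "\<lambda>d. (0, d)" "borel \<Otimes>\<^sub>M borel"]
    have ind: "indep_var (borel \<Otimes>\<^sub>M borel) Y (borel \<Otimes>\<^sub>M borel) (\<lambda>\<omega>. (0, D \<omega>))"
      by (simp add: D_def[abs_def])
    have [measurable]: "Y \<in> measurable P (borel \<Otimes>\<^sub>M borel)" "D \<in> borel_measurable P"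
      using indep_var_rv1[OF ind] by (auto simp: D_def[abs_def])
    have joint: "L \<Otimes>\<^sub>M N = distr P ((borel \<Otimes>\<^sub>M borel) \<Otimes>\<^sub>M (borel \<Otimes>\<^sub>M borel)) (\<lambda>\<omega>. (Y \<omega>, 0, D \<omega>))"
      using ind unfolding indep_var_distribution_eq L_def N_def by simp
    have D: "distr P borel D = density lborel (\<lambda>y. ennreal (normal_density 0 (sqrt (t - s)) y))"
    proof -
      have "distr P borel D = distr P lborel D" by (rule distr_cong) simp_all
      then show ?thesis
        using distributed_distr_eq_density[OF W_increment_distributed[OF st]] by (simp add: D_def[abs_def])
    qed
    interpret L: prob_space L unfolding L_def by (rule prob_space_distr) simp
    interpret N: prob_space N unfolding N_def by (rule prob_space_distr) simp
    interpret LN: pair_prob_space L N ..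
    define G where "G p = fst (fst p) * f (snd (fst p) + snd (snd p))"
      for p :: "(real \<times> real) \<times> (real \<times> real)"
    have G [measurable]: "G \<in> borel_measurable ((borel \<Otimes>\<^sub>M borel) \<Otimes>\<^sub>M (borel \<Otimes>\<^sub>M borel))"
      unfolding G_def[abs_def] by measurable
    have G_YD: "G (Y \<omega>, 0, D \<omega>) = indicator A \<omega> * f (W t \<omega>)" for \<omega>
      by (simp add: G_def Y_def D_def)
    have "integrable P (\<lambda>\<omega>. indicator A \<omega> * f (W t \<omega>))"
      using integrable_mult_indicator[OF AP int] by simp
    then have intG: "integrable (L \<Otimes>\<^sub>M N) G"
      unfolding joint by (subst integrable_distr_eq) (simp_all add: G_YD)
    have inner: "(\<integral>y. G (x, y) \<partial>N) = fst x * heat (t - s) f (snd x)" for x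
    proof -
      have "(\<integral>y. G (x, y) \<partial>N) = fst x * (\<integral>\<omega>. f (snd x + D \<omega>) \<partial>P)"
        unfolding N_def G_def by (subst integral_distr) simp_all
      also have "(\<integral>\<omega>. f (snd x + D \<omega>) \<partial>P) = (\<integral>y. f (snd x + y) \<partial>distr P borel D)"
        by (subst integral_distr) simp_all
      finally show ?thesis
        unfolding D by (simp add: heat_eq_integral_density)
    qed
    have intL: "integrable L (\<lambda>x. fst x * heat (t - s) f (snd x))"
      using LN.integrable_fst'[OF intG] by (simp add: inner)
    have "(\<integral>\<omega>. indicator A \<omega> * f (W t \<omega>) \<partial>P) = (\<integral>p. G p \<partial>(L \<Otimes>\<^sub>M N))"
      unfolding joint by (subst integral_distr) (simp_all add: G_YD)
    also have "\<dots> = (\<integral>x. fst x * heat (t - s) f (snd x) \<partial>L)"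
      using LN.integral_fst'[OF intG] by (simp add: inner)
    also have "\<dots> = (\<integral>\<omega>. indicator A \<omega> * heat (t - s) f (W s \<omega>) \<partial>P)"
      unfolding L_def by (subst integral_distr) (simp_all add: Y_def)
    finally show ?thesis
      using intL unfolding L_def by (subst (asm) integrable_distr_eq) (simp_all add: Y_def)
  qed
  \<comment> \<open>Testing with the whole space gives integrability of the candidate conditional
    expectation.\<close>
  have "space P \<in> sets ?F" by (metis sets.top space_nat_filtration)
  from main[OF this] have "integrable P (\<lambda>\<omega>. indicator (space P) \<omega> * heat (t - s) f (W s \<omega>))" ..
  also have "?this \<longleftrightarrow> integrable P (\<lambda>\<omega>. heat (t - s) f (W s \<omega>))"
    by (rule Bochner_Integration.integrable_cong) auto
  finally have int_heat: "integrable P (\<lambda>\<omega>. heat (t - s) f (W s \<omega>))" .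
  show ?thesis
  proof (rule F.real_cond_exp_charact[OF _ int int_heat])
    fix A assume "A \<in> sets ?F"
    from main[OF this]
    show "(\<integral>\<omega>\<in>A. f (W t \<omega>) \<partial>P) = (\<integral>\<omega>\<in>A. heat (t - s) f (W s \<omega>) \<partial>P)"
      by (simp add: set_lebesgue_integral_def)
  qed measurable
qed

subsection \<open>Martingales of Brownian motion\<close>

lemma AE_W_iff:
  assumes "t > 0" "Measurable.pred borel Q"
  shows "(AE \<omega> in P. Q (W t \<omega>)) \<longleftrightarrow> (AE x in lborel. Q x)"
  using AE_normal_distributed_iff[OF W_distributed[OF assms(1)]] assms by simp

lemma expectation_W:
  assumes "t > 0" "f \<in> borel_measurable borel"
  shows "(\<integral>\<omega>. f (W t \<omega>) \<partial>P) = heat t f 0"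
  using distributed_integral[OF W_distributed[OF assms(1)], of f] assms(2) by (simp add: heat_def)

lemma expectation_W_0:
  fixes f :: "real \<Rightarrow> real"
  assumes [measurable]: "f \<in> borel_measurable borel"
  shows "(\<integral>\<omega>. f (W 0 \<omega>) \<partial>P) = f 0"
proof -
  have "(\<integral>\<omega>. f (W 0 \<omega>) \<partial>P) = (\<integral>\<omega>. f 0 \<partial>P)"
    by (rule integral_cong_AE) (use W_0 in auto)
  then show ?thesis by (simp add: prob_space)
qed

lemma gauss_integrable_W:
  assumes f: "f \<in> borel_measurable borel" and int: "\<And>t. t > 0 \<Longrightarrow> integrable P (\<lambda>\<omega>. f (W t \<omega>))"
  shows "gauss_integrable f"
proof (rule gauss_integrableI[OF f])
  fix u :: real assume u: "u > 0"
  show "integrable lborel (\<lambda>y. normal_density 0 (sqrt u) y * f y)"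
    using distributed_integrable[OF W_distributed[OF u], of f] int[OF u] f by simp
qed

text \<open>The Markov property gives the identity along \<open>W s\<close>. For
  \<open>s > 0\<close> the law of \<open>W s\<close> has the null sets of Lebesgue measure, so it
  transfers to almost every \<open>x\<close>. The compensator \<open>g\<close> may be any function
  of time.\<close>

lemma martingale_imp_AE_heat:
  assumes f: "f \<in> borel_measurable borel" and integ: "\<forall>t\<ge>0. integrable P (\<lambda>\<omega>. f (W t \<omega>))"
    and mart: "martingale_wrt P (nat_filtration P W) (\<lambda>t \<omega>. f (W t \<omega>) - g t)"
    and s: "s > 0" and u: "u > 0"
  shows "AE x in lborel. heat u f x = f x + (g (s + u) - g s)"
proof -
  have fi: "gauss_integrable f"
    using gauss_integrable_W[OF f] integ by simp
  note [measurable] = f heat_measurable[OF f]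
  have "AE \<omega> in P. real_cond_exp P (nat_filtration P W s) (\<lambda>\<omega>. f (W (s + u) \<omega>) - g (s + u)) \<omega>
      = heat u f (W s \<omega>) - g (s + u)"
    using cond_exp_W[of s "s + u" "\<lambda>y. f y - g (s + u)"] s u integ f
    by (simp add: heat_diff_const[OF fi u])
  moreover have "AE \<omega> in P. f (W s \<omega>) - g s
      = real_cond_exp P (nat_filtration P W s) (\<lambda>\<omega>. f (W (s + u) \<omega>) - g (s + u)) \<omega>"
    using mart s u by (auto simp: martingale_wrt_def)
  ultimately have "AE \<omega> in P. heat u f (W s \<omega>) = f (W s \<omega>) + (g (s + u) - g s)"
    by eventually_elim simp
  then show ?thesis
    by (subst (asm) AE_W_iff[OF s]) auto
qed

lemma martingale_imp_AE_quadratic: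
  assumes f: "f \<in> borel_measurable borel" and integ: "\<forall>t\<ge>0. integrable P (\<lambda>\<omega>. f (W t \<omega>))"
    and mart: "martingale_wrt P (nat_filtration P W) (\<lambda>t \<omega>. f (W t \<omega>) - g t)"
  shows "\<exists>a b c. AE x in lborel. f x = a * x\<^sup>2 + b * x + c"
proof -
  note AE_heat = martingale_imp_AE_heat[OF f integ mart]
  have fi: "gauss_integrable f"
    using gauss_integrable_W[OF f] integ by simp
  \<comment> \<open>Time 1 serves as a positive reference time, since the law of \<open>W 0\<close>
    is a point mass.\<close>
  define h where "h u = g (1 + u) - g 1" for u
  have AE_h: "AE x in lborel. heat u f x = f x + h u" if "u > 0" for u
    using AE_heat[of 1 u] that by (simp add: h_def)
  \<comment> \<open>Comparing the identities at starting times \<open>s\<close> and 1 shows two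
    constants to be equal almost everywhere, hence equal.\<close>
  have h: "g (s + u) - g s = h u" if "s > 0" "u > 0" for s u
  proof -
    have "AE x::real in lborel. g (s + u) - g s = h u"
      using AE_heat[OF that] AE_h[OF that(2)] by eventually_elim simp
    moreover have "ae_filter (lborel :: real measure) \<noteq> bot"
      by (simp add: ae_filter_eq_bot_iff)
    ultimately show ?thesis
      by (simp add: eventually_const_iff)
  qed
  \<comment> \<open>The compensator is telescoped from time 1 to time 2 in n steps of length 1/n,
    each contributing the same amount. This makes \<open>h 1\<close> the leading
    coefficient.\<close>
  have h_frac: "h (1 / real n) = h 1 / real n" if n: "n \<ge> 1" for n
  proof -
    have "g (1 + real k / real n) - g 1 = real k * h (1 / real n)" for k
    proof (induction k)
      case (Suc k)
      have "g (1 + real k / real n + 1 / real n) - g (1 + real k / real n) = h (1 / real n)"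
        using n by (intro h) (auto intro: add_pos_nonneg)
      then show ?case using Suc by (simp add: add_divide_distrib algebra_simps)
    qed simp
    from this[of n] show ?thesis using n by (simp add: h_def field_simps)
  qed
  \<comment> \<open>This is the continuous version of \<open>f\<close> read off from the identity at
    \<open>u = 1\<close>.\<close>
  define \<phi> where "\<phi> x = 1 * heat 1 f x + (0 * x\<^sup>2 + 0 * x + - h 1)" for x
  have f\<phi>: "AE x in lborel. f x = \<phi> x"
    using AE_h[OF zero_less_one] by eventually_elim (simp add: \<phi>_def)
  have \<phi>_cont: "continuous_on UNIV \<phi>"
    unfolding \<phi>_def by (intro continuous_intros continuous_on_heat fi) simp
  have \<phi>_meas: "\<phi> \<in> borel_measurable borel"
    using \<phi>_cont by (rule borel_measurable_continuous_onI)
  have \<phi>i: "gauss_integrable \<phi>"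
  proof (rule gauss_integrableI[OF \<phi>_meas])
    fix u :: real assume "u > 0"
    then have "integrable lborel (\<lambda>y. normal_density 0 (sqrt u) y * f y)"
      using fi by (simp add: gauss_integrable_def)
    also have "?this \<longleftrightarrow> integrable lborel (\<lambda>y. normal_density 0 (sqrt u) y * \<phi> y)"
      by (rule integrable_cong_AE) (use f\<phi> f \<phi>_meas in auto)
    finally show "integrable lborel (\<lambda>y. normal_density 0 (sqrt u) y * \<phi> y)" .
  qed
  have "heat u \<phi> x = \<phi> x + h u" if "u > 0" for u x
  proof (rule AE_lborel_eq_imp_eq[of "heat u \<phi>" "\<lambda>x. \<phi> x + h u"])
    show "continuous_on UNIV (heat u \<phi>)" by (rule continuous_on_heat[OF \<phi>i that])
    show "continuous_on UNIV (\<lambda>x. \<phi> x + h u)" by (intro continuous_intros \<phi>_cont)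
    have "heat u \<phi> x = heat u f x" for x
      by (rule heat_cong_AE[symmetric]) (use f\<phi> f \<phi>_meas in auto)
    then show "AE x in lborel. heat u \<phi> x = \<phi> x + h u"
      using AE_h[OF that] f\<phi> by auto
  qed
  then have "\<exists>b c. \<forall>x. \<phi> x = h 1 * x\<^sup>2 + b * x + c"
    by (intro heat_translate_quadratic[OF \<phi>i \<phi>_cont]) (simp add: h_frac)
  then obtain b c where "\<forall>x. \<phi> x = h 1 * x\<^sup>2 + b * x + c"
    by blast
  then have "AE x in lborel. f x = h 1 * x\<^sup>2 + b * x + c"
    using f\<phi> by simp
  then show ?thesis by blast
qed

section \<open>From quadratic functions to martingales\<close>

lemma expectation_AE_quadratic:
  assumes f: "f \<in> borel_measurable borel" and t: "t > 0"
    and q: "AE x in lborel. f x = a * x\<^sup>2 + b * x + c"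
  shows "(\<integral>\<omega>. f (W t \<omega>) \<partial>P) = a * t + c"
proof -
  have "(\<integral>\<omega>. f (W t \<omega>) \<partial>P) = heat t f 0"
    by (rule expectation_W[OF t f])
  also have "\<dots> = heat t (\<lambda>x. a * x\<^sup>2 + b * x + c) 0"
    by (rule heat_cong_AE[OF q f]) simp
  finally show ?thesis
    using heat_quadratic[OF t] by simp
qed

text \<open>Almost surely M_t = a W_t^2 + b W_t - a t, and the semigroup at time t - s adds a (t -
  s), which turns - a t into - a s.\<close>

lemma AE_quadratic_imp_martingale:
  assumes f: "f \<in> borel_measurable borel" and integ: "\<forall>t\<ge>0. integrable P (\<lambda>\<omega>. f (W t \<omega>))"
    and q: "AE x in lborel. f x = a * x\<^sup>2 + b * x + c"
  shows "martingale_wrt P (nat_filtration P W) (\<lambda>t \<omega>. f (W t \<omega>) - (\<integral>\<omega>'. f (W t \<omega>') \<partial>P))"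
    (is "martingale_wrt P _ ?M")
  unfolding martingale_wrt_def
proof (intro conjI allI impI)
  note f [measurable]
  fix t :: real assume t: "0 \<le> t"
  have [measurable]: "W t \<in> borel_measurable (nat_filtration P W t)"
    using W_adapted t by simp
  show "?M t \<in> borel_measurable (nat_filtration P W t)" by measurable
  show "integrable P (?M t)" using integ t by simp
next
  fix s t :: real assume "0 \<le> s \<and> s \<le> t"
  then have st: "0 \<le> s" "s \<le> t" by auto
  note f [measurable]
  interpret F: sigma_finite_subalgebra P "nat_filtration P W s"
    by (rule sigma_finite_subalgebra_nat_filtration)
  \<comment> \<open>At time 0 the value \<open>f 0\<close> may differ from \<open>c\<close>, but
    centring makes M_0 vanish almost surely all the same.\<close>
  have M_eq: "AE \<omega> in P. ?M r \<omega> = a * (W r \<omega>)\<^sup>2 + b * W r \<omega> + - a * r" if "0 \<le> r" for r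
  proof (cases "r = 0")
    case True
    then show ?thesis using W_0 by (auto simp: expectation_W_0[OF f])
  next
    case False
    then have r: "r > 0" using that by simp
    have "AE \<omega> in P. f (W r \<omega>) = a * (W r \<omega>)\<^sup>2 + b * W r \<omega> + c"
      using q by (subst AE_W_iff[OF r]) auto
    then show ?thesis
      using expectation_AE_quadratic[OF f r q] by auto
  qed
  show "AE \<omega> in P. ?M s \<omega> = real_cond_exp P (nat_filtration P W s) (?M t) \<omega>"
  proof (cases "s = t")
    case True
    have [measurable]: "W t \<in> borel_measurable (nat_filtration P W t)"
      using W_adapted st by simp
    have "AE \<omega> in P. real_cond_exp P (nat_filtration P W s) (?M t) \<omega> = ?M t \<omega>"
      by (rule F.real_cond_exp_F_meas) (use integ st True in auto)
    then show ?thesis using True by auto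
  next
    case False
    then have st': "s < t" using st by simp
    let ?q = "\<lambda>x. a * x\<^sup>2 + b * x + - a * t"
    have [measurable]: "W t \<in> borel_measurable P" using st by simp
    have qi: "integrable P (\<lambda>\<omega>. ?q (W t \<omega>))"
    proof (rule integrable_cong_AE_imp)
      show "integrable P (?M t)" using integ st by simp
      show "AE \<omega> in P. ?M t \<omega> = ?q (W t \<omega>)"
        using M_eq[of t] st by auto
    qed measurable
    have "AE \<omega> in P. real_cond_exp P (nat_filtration P W s) (?M t) \<omega>
        = real_cond_exp P (nat_filtration P W s) (\<lambda>\<omega>. ?q (W t \<omega>)) \<omega>"
      by (rule F.real_cond_exp_cong) (use M_eq[of t] st in auto)
    moreover have "AE \<omega> in P. real_cond_exp P (nat_filtration P W s) (\<lambda>\<omega>. ?q (W t \<omega>)) \<omega>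
        = heat (t - s) ?q (W s \<omega>)"
      by (rule cond_exp_W[OF st(1) st' _ qi]) simp
    moreover have "heat (t - s) ?q x = a * x\<^sup>2 + b * x + - a * s" for x
      using st' by (subst heat_quadratic) (simp_all add: algebra_simps)
    ultimately show ?thesis
      using M_eq[OF st(1)] by auto
  qed
qed

section \<open>Right-continuity and pointwise identification\<close>

lemma quadratic_imp_continuous:
  assumes q: "\<And>x. f x = a * x\<^sup>2 + b * x + c"
  shows "AE \<omega> in P. \<forall>t\<ge>0. ((\<lambda>s. f (W s \<omega>) - (\<integral>\<omega>'. f (W s \<omega>') \<partial>P)) \<longlongrightarrow>
      f (W t \<omega>) - (\<integral>\<omega>'. f (W t \<omega>') \<partial>P)) (at_right t)"
  using W_continuous
proof eventually_elim
  case (elim \<omega>)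
  have "f = (\<lambda>x. a * x\<^sup>2 + b * x + c)" using q by auto
  then have f: "f \<in> borel_measurable borel" by simp
  have mean: "(\<integral>\<omega>. f (W t \<omega>) \<partial>P) = a * t + c" if "0 \<le> t" for t
    using expectation_AE_quadratic[OF f, of t a b c] expectation_W_0[OF f] q that
    by (cases "t = 0") auto
  show ?case
  proof (intro allI impI)
    fix t :: real assume t: "0 \<le> t"
    have "((\<lambda>s. W s \<omega>) \<longlongrightarrow> W t \<omega>) (at t within {0..})"
      using elim t by (simp add: continuous_on_def)
    then have "((\<lambda>s. W s \<omega>) \<longlongrightarrow> W t \<omega>) (at_right t)"
      by (rule tendsto_within_subset) (use t in auto)
    then have "((\<lambda>s. f (W s \<omega>) - (a * s + c)) \<longlongrightarrow> f (W t \<omega>) - (a * t + c)) (at_right t)"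
      unfolding q by (intro tendsto_intros)
    moreover have "\<forall>\<^sub>F s in at_right t. f (W s \<omega>) - (a * s + c) = f (W s \<omega>) - (\<integral>\<omega>'. f (W s \<omega>') \<partial>P)"
      using eventually_at_right_less[of t] by eventually_elim (use t mean in auto)
    ultimately show "((\<lambda>s. f (W s \<omega>) - (\<integral>\<omega>'. f (W s \<omega>') \<partial>P)) \<longlongrightarrow>
      f (W t \<omega>) - (\<integral>\<omega>'. f (W t \<omega>') \<partial>P)) (at_right t)"
      by (subst mean[OF t]) (rule Lim_transform_eventually)
  qed
qed

text \<open>\<open>W 1\<close> in (x - 1, x) and an increment above 1 are independent events of
  positive probability, and together they force the crossing. The negated \<open>AE\<close> form
  combines directly with almost sure properties.\<close>

lemma crossing_not_null: "\<not> (AE \<omega> in P. \<not> (W 1 \<omega> < x \<and> x < W 2 \<omega>))"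
proof
  assume "AE \<omega> in P. \<not> (W 1 \<omega> < x \<and> x < W 2 \<omega>)"
  then have null: "AE \<omega> in P. \<omega> \<notin> (\<lambda>\<omega>. (W 1 \<omega>, W 2 \<omega> - W 1 \<omega>)) -` ({x - 1<..<x} \<times> {1<..}) \<inter> space P"
    by eventually_elim auto
  have ind: "indep_var borel (W 1) borel (\<lambda>\<omega>. W 2 \<omega> - W 1 \<omega>)"
    using indep_var_nat_filtration_increment[of 1 2 "W 1" borel "\<lambda>x. x"] W_adapted[of 1 1] by simp
  have [measurable]: "W 1 \<in> borel_measurable P" "W 2 \<in> borel_measurable P" by auto
  have "prob (W 1 -` {x - 1<..<x} \<inter> space P) > 0"
    by (rule prob_normal_interval_pos[OF W_distributed]) (auto simp: ex_in_conv[symmetric] intro!: dense)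
  moreover have "prob ((\<lambda>\<omega>. W 2 \<omega> - W 1 \<omega>) -` {1<..} \<inter> space P) > 0"
    by (rule prob_normal_interval_pos[OF W_increment_distributed]) auto
  ultimately have "prob ((\<lambda>\<omega>. (W 1 \<omega>, W 2 \<omega> - W 1 \<omega>)) -` ({x - 1<..<x} \<times> {1<..}) \<inter> space P) > 0"
    by (subst indep_varD[OF ind]) auto
  moreover have "prob ((\<lambda>\<omega>. (W 1 \<omega>, W 2 \<omega> - W 1 \<omega>)) -` ({x - 1<..<x} \<times> {1<..}) \<inter> space P) = 0"
    by (rule prob_eq_0[THEN iffD2]) (use null in measurable)
  ultimately show False by simp
qed

text \<open>With positive probability the path hits \<open>x\<close> at a positive time \<open>T\<close>. The path avoids the
  exceptional null set of \<open>f\<close> at all positive rational times, so that \<open>f x\<close> is the limit of the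
  quadratic along rational times decreasing to \<open>T\<close>.\<close>

lemma right_continuous_AE_quadratic_imp_quadratic:
  assumes f: "f \<in> borel_measurable borel"
    and q: "AE x in lborel. f x = a * x\<^sup>2 + b * x + c"
    and cont: "AE \<omega> in P. \<forall>t\<ge>0. ((\<lambda>s. f (W s \<omega>) - (\<integral>\<omega>'. f (W s \<omega>') \<partial>P)) \<longlongrightarrow>
      f (W t \<omega>) - (\<integral>\<omega>'. f (W t \<omega>') \<partial>P)) (at_right t)"
  shows "f x = a * x\<^sup>2 + b * x + c"
proof -
  note f [measurable]
  \<comment> \<open>Countably many fixed times allow a common exceptional null set; the hitting time
    depends on the path and cannot be handled this way.\<close>
  have "AE \<omega> in P. \<forall>r\<in>\<rat> \<inter> {0<..}. f (W r \<omega>) = a * (W r \<omega>)\<^sup>2 + b * W r \<omega> + c"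
  proof (subst AE_ball_countable)
    show "countable (\<rat> \<inter> {0<..} :: real set)" by (simp add: countable_rat)
    show "\<forall>r\<in>\<rat> \<inter> {0<..}. AE \<omega> in P. f (W r \<omega>) = a * (W r \<omega>)\<^sup>2 + b * W r \<omega> + c"
    proof
      fix r :: real assume "r \<in> \<rat> \<inter> {0<..}"
      then have "r > 0" by simp
      then show "AE \<omega> in P. f (W r \<omega>) = a * (W r \<omega>)\<^sup>2 + b * W r \<omega> + c"
        using q by (subst AE_W_iff) auto
    qed
  qed
  then have good: "AE \<omega> in P. continuous_on {0..} (\<lambda>t. W t \<omega>)
      \<and> (\<forall>r\<in>\<rat> \<inter> {0<..}. f (W r \<omega>) = a * (W r \<omega>)\<^sup>2 + b * W r \<omega> + c)
      \<and> (\<forall>t\<ge>0. ((\<lambda>s. f (W s \<omega>) - (\<integral>\<omega>'. f (W s \<omega>') \<partial>P)) \<longlongrightarrow>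
            f (W t \<omega>) - (\<integral>\<omega>'. f (W t \<omega>') \<partial>P)) (at_right t))"
    (is "AE \<omega> in P. ?good \<omega>")
    using W_continuous cont by eventually_elim auto
  \<comment> \<open>The crossing event is not null, so it contains a path with all the almost sure
    properties.\<close>
  obtain \<omega> where \<omega>: "?good \<omega>" "W 1 \<omega> < x" "x < W 2 \<omega>"
  proof (rule ccontr)
    assume "\<not> thesis"
    then have "\<not> (W 1 \<omega> < x \<and> x < W 2 \<omega>)" if "?good \<omega>" for \<omega>
      using that \<open>\<And>\<omega>. ?good \<omega> \<Longrightarrow> W 1 \<omega> < x \<Longrightarrow> x < W 2 \<omega> \<Longrightarrow> thesis\<close> by blast
    with good have "AE \<omega> in P. \<not> (W 1 \<omega> < x \<and> x < W 2 \<omega>)"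
      by (rule eventually_mono)
    with crossing_not_null show False by blast
  qed
  have "continuous_on {1..2} (\<lambda>t. W t \<omega>)"
    using \<omega>(1) by (auto intro: continuous_on_subset)
  then obtain T where T: "1 \<le> T" "T \<le> 2" "W T \<omega> = x"
    using IVT'[of "\<lambda>t. W t \<omega>" 1 x 2] \<omega> by auto
  have "\<exists>r\<in>\<rat>. T < r \<and> r < T + 1 / real (Suc n)" for n
    by (rule Rats_dense_in_real) simp
  then obtain r where r: "\<And>n. r n \<in> \<rat>" "\<And>n. T < r n" "\<And>n. r n < T + 1 / real (Suc n)"
    by metis
  have rT: "r \<longlonglongrightarrow> T"
  proof (rule real_tendsto_sandwich[where f = "\<lambda>_. T" and h = "\<lambda>n. T + 1 / real (Suc n)"])
    show "(\<lambda>n. T + 1 / real (Suc n)) \<longlonglongrightarrow> T"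
      using tendsto_add[OF tendsto_const LIMSEQ_Suc[OF lim_1_over_n]] by simp
  qed (use less_imp_le[OF r(2)] less_imp_le[OF r(3)] in auto)
  have r_right: "filterlim r (at_right T) sequentially"
    using rT r(2) by (simp add: filterlim_at less_imp_neq[symmetric])
  have mean: "(\<integral>\<omega>. f (W t \<omega>) \<partial>P) = a * t + c" if "t \<ge> T" for t
    using expectation_AE_quadratic[OF f _ q] that T by simp
  have "((\<lambda>s. f (W s \<omega>) - (\<integral>\<omega>'. f (W s \<omega>') \<partial>P)) \<longlongrightarrow> f x - (a * T + c)) (at_right T)"
  proof -
    have "((\<lambda>s. f (W s \<omega>) - (\<integral>\<omega>'. f (W s \<omega>') \<partial>P)) \<longlongrightarrow>
        f (W T \<omega>) - (\<integral>\<omega>'. f (W T \<omega>') \<partial>P)) (at_right T)"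
      using \<omega>(1) T(1) by (meson order_trans zero_le_one)
    then show ?thesis by (simp only: mean[OF order_refl] T(3))
  qed
  from filterlim_compose[OF this r_right]
  have "(\<lambda>n. f (W (r n) \<omega>) - (a * r n + c)) \<longlonglongrightarrow> f x - (a * T + c)"
    using mean[OF less_imp_le[OF r(2)]] by simp
  moreover have "f (W (r n) \<omega>) = a * (W (r n) \<omega>)\<^sup>2 + b * W (r n) \<omega> + c" for n
    using \<omega>(1) r(1,2)[of n] T by auto
  ultimately have 1: "(\<lambda>n. a * (W (r n) \<omega>)\<^sup>2 + b * W (r n) \<omega> + c - (a * r n + c)) \<longlonglongrightarrow> f x - (a * T + c)"
    by simp
  \<comment> \<open>The same sequence is now evaluated by path continuity; uniqueness of limits
    identifies \<open>f x\<close>.\<close>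
  have "(\<lambda>n. W (r n) \<omega>) \<longlonglongrightarrow> W T \<omega>"
  proof (rule continuous_on_tendsto_compose[of "{0..}" "\<lambda>t. W t \<omega>"])
    show "\<forall>\<^sub>F n in sequentially. r n \<in> {0..}"
      using order_less_trans[OF order_less_le_trans[OF zero_less_one T(1)] r(2)]
      by (intro always_eventually allI) (simp add: less_imp_le)
  qed (use \<omega>(1) rT T in auto)
  then have "(\<lambda>n. a * (W (r n) \<omega>)\<^sup>2 + b * W (r n) \<omega> + c - (a * r n + c))
      \<longlonglongrightarrow> a * x\<^sup>2 + b * x + c - (a * T + c)"
    unfolding T(3) by (intro tendsto_intros rT)
  from LIMSEQ_unique[OF 1 this] show ?thesis by simp
qed

end

theorem theorem2:
  fixes P :: "'a measure" and W :: "real \<Rightarrow> 'a \<Rightarrow> real" and f :: "real \<Rightarrow> real"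
  assumes BM: "std_brownian_motion P W"
    and complete: "complete_measure P"
    and meas: "f \<in> borel_measurable borel"
    and integ: "\<forall>t\<ge>0. integrable P (\<lambda>\<omega>. f (W t \<omega>))"
  shows "((martingale_wrt P (nat_filtration P W)
            (\<lambda>t \<omega>. f (W t \<omega>) - (\<integral>\<omega>'. f (W t \<omega>') \<partial>P)) \<and>
          (AE \<omega> in P. \<forall>t\<ge>0.
             ((\<lambda>s. f (W s \<omega>) - (\<integral>\<omega>'. f (W s \<omega>') \<partial>P)) \<longlongrightarrow>
               f (W t \<omega>) - (\<integral>\<omega>'. f (W t \<omega>') \<partial>P)) (at_right t)))
         \<longleftrightarrow> (\<exists>a b c. \<forall>x. f x = a * x\<^sup>2 + b * x + c))
         \<and>
         (martingale_wrt P (nat_filtration P W)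
            (\<lambda>t \<omega>. f (W t \<omega>) - (\<integral>\<omega>'. f (W t \<omega>') \<partial>P))
         \<longleftrightarrow> (\<exists>a b c. AE x in lborel. f x = a * x\<^sup>2 + b * x + c))"
proof -
  interpret brownian_motion P W by unfold_locales (rule BM)
  \<comment> \<open>The almost everywhere statement comes first: it supplies the coefficients in
    (a), and right-continuity then removes the exceptional null set.\<close>
  have b: "martingale_wrt P (nat_filtration P W) (\<lambda>t \<omega>. f (W t \<omega>) - (\<integral>\<omega>'. f (W t \<omega>') \<partial>P))
      \<longleftrightarrow> (\<exists>a b c. AE x in lborel. f x = a * x\<^sup>2 + b * x + c)"
  proof
    show "\<exists>a b c. AE x in lborel. f x = a * x\<^sup>2 + b * x + c"
      if "martingale_wrt P (nat_filtration P W) (\<lambda>t \<omega>. f (W t \<omega>) - (\<integral>\<omega>'. f (W t \<omega>') \<partial>P))"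
      using martingale_imp_AE_quadratic[OF meas integ that] .
  qed (use AE_quadratic_imp_martingale[OF meas integ] in blast)
  moreover have "\<exists>a b c. AE x in lborel. f x = a * x\<^sup>2 + b * x + c"
    if "\<exists>a b c. \<forall>x. f x = a * x\<^sup>2 + b * x + c"
    using that by (elim exE) (intro exI AE_I2, blast)
  ultimately show ?thesis
    using quadratic_imp_continuous[of f]
      right_continuous_AE_quadratic_imp_quadratic[OF meas] by meson
qed

end
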